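(* Let $T \in \mathbb{R}^{m\times n}$ be a cell-to-face incidence matrix (each row has exactly two non-zero entries, one equal to $+1$ and one equal to $-1$), let $\Omega \in \mathbb{R}^{n\times n}$ be a diagonal matrix with strictly positive diagonal entries, and let $F \in \mathbb{R}^{m\times m}$ be a diagonal matrix whose vector of diagonal entries $\operatorname{diag}(F) \in \mathbb{R}^m$ lies in $\ker(T^{T})$. Put $$C = \tfrac12\, T^{T} F\, |T| \in \mathbb{R}^{n\times n}.$$ Let $\alpha \in \mathbb{R}$, where, if $\alpha<0$ or $\alpha>1$, all diagonal entries of $F$ are assumed non-zero. Then $$\rho(\Omega^{-1} C) \;\le\; \tfrac14\, \rho\!\left( |F|^{\alpha}\, \big|T\, \Omega^{-1} T^{T}\big|\, |F|^{1-\alpha} \right) \;\le\; \tfrac14 \max\left\{ \operatorname{diag}(|F|^{\alpha}) \circ \Big( \big|T\, \Omega^{-1} T^{T}\big| \operatorname{diag}(|F|^{1-\alpha}) \Big) \right\}.$$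
   Context: $n$ is the number of cells (control volumes) and $m$ the number of faces of a mesh; rows of $T$ are indexed by faces and columns by cells, the two non-zero entries of a row being located at the two cells adjacent to that face. $\Omega$ contains the cell volumes, $F$ the mass fluxes through the faces, and $C$ is the discrete (symmetry-preserving) convective operator; the condition $\operatorname{diag}(F)\in\ker(T^T)$ expresses discrete incompressibility. Notation: $\rho(\cdot)$ is the spectral radius (maximum modulus of the complex eigenvalues). For a real matrix $A$, $|A|$ is the entry-wise absolute value, $[|A|]_{ij} = |[A]_{ij}|$. For a diagonal matrix $D$, $\operatorname{diag}(D)$ is the column vector of its diagonal entries. $|F|^{\beta}$ is the diagonal matrix with entries $|[F]_{jj}|^{\beta}$, with $|F|^{0}$ equal to the identity (so $0^0=1$). $\circ$ is the entry-wise (Hadamard) product of vectors, and $\max\{v\}$ is the largest component of the vector $v$. *)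

theory Defs
  imports
    "Jordan_Normal_Form.Spectral_Radius"
    "Jordan_Normal_Form.Gauss_Jordan_Elimination"
    "Jordan_Normal_Form.Matrix_Kernel"
begin

definition cell_to_face_incidence :: "real mat \<Rightarrow> bool" where
  "cell_to_face_incidence T \<longleftrightarrow>
     (\<forall>i<dim_row T. \<exists>j<dim_col T. \<exists>k<dim_col T.
        T $$ (i,j) = 1 \<and> T $$ (i,k) = -1 \<and>
        (\<forall>l<dim_col T. l \<noteq> j \<and> l \<noteq> k \<longrightarrow> T $$ (i,l) = 0))"

abbreviation abs_mat :: "real mat \<Rightarrow> real mat" where
  "abs_mat A \<equiv> map_mat abs A"

abbreviation diag_vec :: "real mat \<Rightarrow> real vec" where
  "diag_vec D \<equiv> vec_of_list (diag_mat D)"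

(* The case distinction is needed because 0 powr 0 = 0 in HOL, whereas here 0^0 = 1. *)
definition abs_diag_powr :: "real mat \<Rightarrow> real \<Rightarrow> real mat" where
  "abs_diag_powr D \<beta> =
     mat_diag (dim_row D) (\<lambda>j. if \<beta> = 0 then 1 else \<bar>D $$ (j,j)\<bar> powr \<beta>)"

(* Only meaningful for invertible matrices; see mat_inverse_diagonal below for the case used. *)
abbreviation mat_inv :: "real mat \<Rightarrow> real mat" where
  "mat_inv A \<equiv> the (mat_inverse A)"

abbreviation real_spectral_radius :: "real mat \<Rightarrow> real" (\<open>\<rho>\<close>) where
  "\<rho> A \<equiv> spectral_radius (map_mat complex_of_real A)"

lemma mat_inverse_diagonal:
  fixes D :: "real mat"
  assumes D: "D \<in> carrier_mat n n" and diag: "diagonal_mat D"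
    and nz: "\<And>i. i < n \<Longrightarrow> D $$ (i,i) \<noteq> 0"
  shows "mat_inverse D = Some (mat_diag n (\<lambda>i. 1 / D $$ (i,i)))"
proof -
  let ?E = "mat_diag n (\<lambda>i. 1 / D $$ (i,i))"
  have D_eq: "D = mat_diag n (\<lambda>i. D $$ (i,i))"
    using D diag by (intro eq_matI) (auto simp: mat_diag_def diagonal_mat_def)
  have E: "?E \<in> carrier_mat n n" by simp
  have one: "mat_diag n f = 1\<^sub>m n" if "\<And>i. i < n \<Longrightarrow> f i = 1" for f :: "nat \<Rightarrow> real"
    using that by (intro eq_matI) (auto simp: mat_diag_def)
  have DE: "D * ?E = 1\<^sub>m n"
    by (subst D_eq, subst mat_diag_diag, rule one) (simp add: nz)
  have ED: "?E * D = 1\<^sub>m n"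
    by (subst (2) D_eq, subst mat_diag_diag, rule one) (simp add: nz)
  have "D \<in> Units (ring_mat TYPE(real) n ())"
    using D E DE ED unfolding Units_def ring_mat_def by auto
  then obtain B where B: "mat_inverse D = Some B"
    using mat_inverse(1)[OF D, where b = "()"] by (cases "mat_inverse D") auto
  from mat_inverse(2)[OF D B] have DB: "D * B = 1\<^sub>m n" and Bc: "B \<in> carrier_mat n n"
    by auto
  have "B = (?E * D) * B" using ED Bc by simp
  also have "\<dots> = ?E * (D * B)" using assoc_mult_mat[OF E D Bc] .
  also have "\<dots> = ?E" unfolding DB by (rule right_mult_one_mat[OF E])
  finally show ?thesis using B by simp
qed

end

theory Submission
  imports Defs "HOL-Analysis.Convex"
begin

text \<open>If \<open>C v = \<lambda> \<Omega> v\<close>, then \<open>\<bar>\<lambda>\<bar> \<cdot> v\<^sup>* \<Omega> v = \<bar>v\<^sup>* C v\<bar>\<close>. Incompressibility reduces \<open>v\<^sup>* C v\<close> to cross terms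
  over the faces, which AM-GM bounds by \<open>1/4\<close> of the quadratic form of \<open>\<bar>T\<bar>\<^sup>T \<bar>F\<bar> \<bar>T\<bar>\<close> at \<open>\<bar>v\<bar>\<close>. With
  \<open>G = \<bar>T\<bar> \<Omega>\<^sup>-\<^sup>1\<^sup>/\<^sup>2\<close> the Rayleigh bound for \<open>G\<^sup>T \<bar>F\<bar> G\<close> gives \<open>\<bar>\<lambda>\<bar> \<le> 1/4 \<rho>(G\<^sup>T \<bar>F\<bar> G)\<close>; cyclic
  permutation of factors and \<open>G G\<^sup>T = \<bar>T \<Omega>\<^sup>-\<^sup>1 T\<^sup>T\<bar>\<close> turn this into the first inequality. The second
  one is the bound of the spectral radius of a nonnegative matrix by its largest row sum.\<close>

unbundle no inner_syntax

section \<open>Entries of matrix products and real scalar products\<close>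

lemma mult_mat_vec_nth:
  assumes "A \<in> carrier_mat m n" "v \<in> carrier_vec n" "i < m"
  shows "(A *\<^sub>v v) $ i = (\<Sum>j<n. A $$ (i,j) * v $ j)"
  using assms by (simp add: scalar_prod_def atLeast0LessThan)

lemma mult_mat_nth:
  assumes "A \<in> carrier_mat m n" "B \<in> carrier_mat n l" "i < m" "j < l"
  shows "(A * B) $$ (i,j) = (\<Sum>k<n. A $$ (i,k) * B $$ (k,j))"
  using assms by (simp add: scalar_prod_def atLeast0LessThan)

lemma scalar_prod_self_nonneg:
  fixes x :: "real vec"
  shows "x \<bullet> x \<ge> 0"
  by (simp add: scalar_prod_def sum_nonneg)

lemma scalar_prod_self_pos:
  fixes x :: "real vec"
  assumes "x \<bullet> y \<noteq> 0" "dim_vec x = dim_vec y"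
  shows "x \<bullet> x > 0"
proof (rule ccontr)
  assume "\<not> x \<bullet> x > 0"
  then have "(\<Sum>i<dim_vec x. (x $ i)\<^sup>2) = 0"
    using scalar_prod_self_nonneg[of x]
    by (simp add: scalar_prod_def atLeast0LessThan power2_eq_square)
  then have "\<forall>i<dim_vec x. x $ i = 0"
    by (subst (asm) sum_nonneg_eq_0_iff) auto
  then have "x \<bullet> y = 0"
    using assms(2) by (simp add: scalar_prod_def)
  with assms(1) show False by simp
qed

lemma scalar_prod_Cauchy_Schwarz:
  fixes x y :: "real vec"
  assumes "dim_vec x = dim_vec y"
  shows "(x \<bullet> y)\<^sup>2 \<le> (x \<bullet> x) * (y \<bullet> y)"
  using Cauchy_Schwarz_ineq_sum[of "\<lambda>i. x $ i" "\<lambda>i. y $ i" "{0..<dim_vec y}"] assms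
  by (simp add: scalar_prod_def power2_eq_square)

section \<open>Extremal eigenvalues and cyclic permutation of factors\<close>

lemma norm_eigenvalue_le_spectral_radius:
  assumes A: "A \<in> carrier_mat n n" and ev: "eigenvalue A k"
  shows "norm k \<le> spectral_radius A"
  using spectral_radius_mem_max(2)[OF A eigenvalue_imp_nonzero_dim[OF A ev]] ev
  by (auto simp: spectrum_def)

lemma maximal_modulus_eigenvalueE:
  assumes "A \<in> carrier_mat n n" and "n > 0"
  obtains k where "eigenvalue A k" and "spectral_radius A = norm k"
  using spectral_radius_mem_max(1)[OF assms] by (auto simp: spectrum_def)

lemma spectral_radius_nonneg:
  assumes "A \<in> carrier_mat n n" and "n > 0"
  shows "spectral_radius A \<ge> 0"
  by (metis maximal_modulus_eigenvalueE[OF assms] norm_ge_zero)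

text \<open>For \<open>k \<noteq> 0\<close>, \<open>B\<close> carries an eigenvector
  \<open>v\<close> of \<open>A * B\<close> to one of \<open>B * A\<close>: the image cannot vanish,
  since \<open>A\<close> sends it to a non-zero multiple of \<open>v\<close>. For
  \<open>k = 0\<close> nonnegativity of the spectral radius is enough. Exchanging the roles of
  \<open>A\<close> and \<open>B\<close> yields equality, also for rectangular factors.\<close>

lemma spectral_radius_mult_commute_le:
  assumes A: "A \<in> carrier_mat m n" and B: "B \<in> carrier_mat n m" and m: "m > 0" and n: "n > 0"
  shows "spectral_radius (A * B) \<le> spectral_radius (B * A)"
proof -
  have BA: "B * A \<in> carrier_mat n n" using A B by simp
  obtain k where k: "eigenvalue (A * B) k" "spectral_radius (A * B) = norm k"
    using maximal_modulus_eigenvalueE[of "A * B" m] A B m by auto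
  show ?thesis
  proof (cases "k = 0")
    case True
    then show ?thesis using k spectral_radius_nonneg[OF BA n] by simp
  next
    case False
    obtain v where v: "v \<in> carrier_vec m" "v \<noteq> 0\<^sub>v m" and ABv: "A * B *\<^sub>v v = k \<cdot>\<^sub>v v"
      using k A unfolding eigenvalue_def eigenvector_def by auto
    have AB: "A *\<^sub>v (B *\<^sub>v v) = k \<cdot>\<^sub>v v" using ABv A B v by simp
    have "B *\<^sub>v v \<noteq> 0\<^sub>v n"
    proof
      assume *: "B *\<^sub>v v = 0\<^sub>v n"
      have "k \<cdot>\<^sub>v v = A *\<^sub>v 0\<^sub>v n" using AB unfolding * by simp
      also have "\<dots> = 0\<^sub>v m" using A by (intro eq_vecI) (auto simp: scalar_prod_def)
      finally have "k \<cdot>\<^sub>v v = 0\<^sub>v m" .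
      then have "v = 0\<^sub>v m" using False v(1) by (auto simp: vec_eq_iff)
      with v show False by simp
    qed
    moreover have "B * A *\<^sub>v (B *\<^sub>v v) = k \<cdot>\<^sub>v (B *\<^sub>v v)"
      using A B v AB by (simp add: mult_mat_vec[OF B])
    ultimately have "eigenvector (B * A) (B *\<^sub>v v) k"
      using A B v unfolding eigenvector_def by simp
    then show ?thesis
      using norm_eigenvalue_le_spectral_radius[OF BA] k unfolding eigenvalue_def by auto
  qed
qed

lemma real_spectral_radius_mult_commute:
  assumes A: "A \<in> carrier_mat m n" and B: "B \<in> carrier_mat n m" and m: "m > 0" and n: "n > 0"
  shows "\<rho> (A * B) = \<rho> (B * A)"
  unfolding of_real_hom.mat_hom_mult[OF A B] of_real_hom.mat_hom_mult[OF B A]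
  using A B m n by (intro antisym spectral_radius_mult_commute_le[where m = m and n = n]
    spectral_radius_mult_commute_le[where m = n and n = m]) auto

section \<open>Rayleigh quotients of symmetric matrices\<close>

text \<open>Normalisation into the regime where all powers of a matrix stay bounded. An eigenvalue
  \<open>k\<close> of the scaled matrix comes from the eigenvalue \<open>c * k\<close> of
  \<open>A\<close>, whose modulus is below \<open>c\<close>.\<close>

lemma spectral_radius_smult_less_1:
  assumes A: "A \<in> carrier_mat n n" and n: "n > 0"
    and c: "spectral_radius A < c"
  shows "spectral_radius (of_real (1 / c) \<cdot>\<^sub>m A) < 1"
proof -
  have c0: "c > 0" using spectral_radius_nonneg[OF A n] c by simp
  obtain k where k: "eigenvalue (of_real (1 / c) \<cdot>\<^sub>m A) k"
      "spectral_radius (of_real (1 / c) \<cdot>\<^sub>m A) = norm k"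
    using maximal_modulus_eigenvalueE[of "of_real (1 / c) \<cdot>\<^sub>m A" n] A n by auto
  then obtain v where v: "v \<in> carrier_vec n" "v \<noteq> 0\<^sub>v n"
      and ev: "(of_real (1 / c) \<cdot>\<^sub>m A) *\<^sub>v v = k \<cdot>\<^sub>v v"
    using A unfolding eigenvalue_def eigenvector_def by auto
  have "A *\<^sub>v v = (of_real c * k) \<cdot>\<^sub>v v"
  proof (intro eq_vecI)
    fix i assume "i < dim_vec ((of_real c * k) \<cdot>\<^sub>v v)"
    then have i: "i < n" using v by simp
    have "((of_real (1 / c) \<cdot>\<^sub>m A) *\<^sub>v v) $ i = k * v $ i" using ev v i by simp
    then have "of_real (1 / c) * (A *\<^sub>v v) $ i = k * v $ i" using A v i by simp
    then have "(A *\<^sub>v v) $ i = of_real c * (k * v $ i)"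
      using c0 by (simp add: field_simps)
    then show "(A *\<^sub>v v) $ i = ((of_real c * k) \<cdot>\<^sub>v v) $ i" using v i by simp
  qed (use A v in auto)
  then have "eigenvalue A (of_real c * k)"
    using A v unfolding eigenvalue_def eigenvector_def by auto
  from norm_eigenvalue_le_spectral_radius[OF A this] have "c * norm k < c * 1"
    using c c0 by (simp only: norm_mult norm_of_real abs_of_pos mult_1_right)
  then have "norm k < 1" using c0 by (simp only: mult_less_cancel_left_pos)
  then show ?thesis using k by simp
qed

text \<open>Matrix powers gain their new factor on the right, whereas the orbit of \<open>x\<close>
  studied next is generated by a factor on the left.\<close>

lemma pow_mat_Suc_mult_vec:
  assumes A: "A \<in> carrier_mat n n" and x: "x \<in> carrier_vec n"
  shows "A ^\<^sub>m Suc k *\<^sub>v x = A *\<^sub>v (A ^\<^sub>m k *\<^sub>v x)"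
  using x
proof (induction k arbitrary: x)
  case 0
  then show ?case using A by simp
next
  case (Suc k)
  have step: "A ^\<^sub>m Suc l *\<^sub>v x = A ^\<^sub>m l *\<^sub>v (A *\<^sub>v x)" for l
    using assoc_mult_mat_vec[OF pow_carrier_mat[OF A] A Suc.prems] by simp
  show ?case
    using Suc.IH[of "A *\<^sub>v x"] A Suc.prems by (simp only: step mult_mat_vec_carrier)
qed

text \<open>For symmetric \<open>H\<close> the sequence \<open>\<bar>H\<^sup>k x\<bar>\<^sup>2\<close> is log-convex by Cauchy-Schwarz, hence grows at
  least like the powers of the squared Rayleigh quotient, whereas \<open>H\<^sup>k\<close> stays bounded
  when the spectral radius is less than one.\<close>

lemma Rayleigh_quotient_less_1:
  fixes H :: "real mat"
  assumes H: "H \<in> carrier_mat n n" and sym: "transpose_mat H = H" and x: "x \<in> carrier_vec n"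
    and bounded: "\<forall>k. norm_bound (H ^\<^sub>m k) b"
  shows "x \<bullet> (H *\<^sub>v x) \<le> x \<bullet> x"
proof (rule ccontr)
  assume "\<not> x \<bullet> (H *\<^sub>v x) \<le> x \<bullet> x"
  then have gt: "x \<bullet> (H *\<^sub>v x) > x \<bullet> x" by simp
  define y where "y k = H ^\<^sub>m k *\<^sub>v x" for k
  define s where "s k = y k \<bullet> y k" for k
  have yc: "y k \<in> carrier_vec n" for k
    using H x mult_mat_vec_carrier[OF pow_carrier_mat[OF H] x] by (simp add: y_def)
  then have yd: "dim_vec (y k) = n" for k by auto
  have y0: "y 0 = x" using H x by (simp add: y_def)
  have yS: "y (Suc k) = H *\<^sub>v y k" for k
    using pow_mat_Suc_mult_vec[OF H x] by (simp add: y_def)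
  \<comment> \<open>Symmetry lets one application of \<open>H\<close> move across the scalar
    product; hence \<open>s (Suc k)\<close> is also \<open>y k \<bullet> y (Suc (Suc k))\<close>,
    the form to which Cauchy-Schwarz is applied.\<close>
  have self_adj: "y (Suc k) \<bullet> y l = y k \<bullet> y (Suc l)" for k l
    using transpose_vec_mult_scalar[OF H yc yc, of k l] by (simp add: sym yS)
  have "x \<bullet> (H *\<^sub>v x) > 0" using gt scalar_prod_self_nonneg[of x] by linarith
  then have s0: "s 0 > 0"
    using scalar_prod_self_pos[of x "H *\<^sub>v x"] H x by (simp add: s_def y0)
  \<comment> \<open>Since \<open>y 0 \<bullet> y 1\<close> is the quadratic form at
    \<open>x\<close>, the assumed violation puts its square strictly between
    \<open>s 0 * s 0\<close> and, by Cauchy-Schwarz, \<open>s 0 * s 1\<close>, with equality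
    possible only on the right.\<close>
  have "(y 0 \<bullet> y 1)\<^sup>2 \<le> s 0 * s 1"
    unfolding s_def by (rule scalar_prod_Cauchy_Schwarz) (simp add: yd)
  moreover have "(s 0)\<^sup>2 < (y 0 \<bullet> y 1)\<^sup>2"
    using gt s0 by (intro power_strict_mono) (simp_all add: s_def yS y0)
  ultimately have "s 0 * s 0 < s 0 * s 1" by (simp add: power2_eq_square)
  then have s01: "s 0 < s 1" using s0 by simp
  \<comment> \<open>The first growth ratio. Log-convexity makes the successive ratios nondecreasing,
    so \<open>q\<close> bounds all of them from below.\<close>
  define q where "q = s 1 / s 0"
  have q: "q > 1" using s0 s01 by (simp add: q_def)
  have step: "s k > 0 \<and> q * s k \<le> s (Suc k)" for k
  proof (induction k)
    case 0
    show ?case using s0 by (simp add: q_def)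
  next
    case (Suc k)
    have pos: "s (Suc k) > 0"
      by (rule less_le_trans[of _ "q * s k"]) (use Suc q in auto)
    have "(s (Suc k))\<^sup>2 = (y k \<bullet> y (Suc (Suc k)))\<^sup>2"
      by (simp add: s_def self_adj)
    also have "\<dots> \<le> s k * s (Suc (Suc k))"
      unfolding s_def by (rule scalar_prod_Cauchy_Schwarz) (simp add: yd)
    finally have "s (Suc k) * s (Suc k) \<le> s k * s (Suc (Suc k))"
      by (simp add: power2_eq_square)
    moreover have "(q * s k) * s (Suc k) \<le> s (Suc k) * s (Suc k)"
      using Suc pos by (intro mult_right_mono) auto
    ultimately have "s k * (q * s (Suc k)) \<le> s k * s (Suc (Suc k))"
      by (simp add: mult_ac)
    then show ?case using Suc pos by simp
  qed
  have growth: "s 0 * q ^ k \<le> s k" for k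
  proof (induction k)
    case (Suc k)
    have "q * (s 0 * q ^ k) \<le> q * s k" using Suc q by (intro mult_left_mono) auto
    also have "\<dots> \<le> s (Suc k)" using step by simp
    finally show ?case by (simp add: mult_ac)
  qed simp
  \<comment> \<open>The bound \<open>b\<close> on the entries of all powers bounds the orbit
    independently of \<open>k\<close>, which contradicts geometric growth with ratio
    \<open>q > 1\<close>.\<close>
  have entry: "\<bar>y k $ i\<bar> \<le> (\<Sum>j<n. b * \<bar>x $ j\<bar>)" if "i < n" for i k
  proof -
    have "\<bar>y k $ i\<bar> \<le> (\<Sum>j<n. \<bar>(H ^\<^sub>m k) $$ (i,j) * x $ j\<bar>)"
      unfolding y_def mult_mat_vec_nth[OF pow_carrier_mat[OF H] x that] by (rule sum_abs)
    also have "\<dots> \<le> (\<Sum>j<n. b * \<bar>x $ j\<bar>)"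
      unfolding abs_mult using bounded H that
      by (intro sum_mono mult_right_mono) (auto simp: norm_bound_def)
    finally show ?thesis .
  qed
  have "s k \<le> (\<Sum>i<n. (\<Sum>j<n. b * \<bar>x $ j\<bar>)\<^sup>2)" for k
    unfolding s_def scalar_prod_def yd atLeast0LessThan
  proof (rule sum_mono)
    fix i assume "i \<in> {..<n}"
    then show "y k $ i * y k $ i \<le> (\<Sum>j<n. b * \<bar>x $ j\<bar>)\<^sup>2"
      using power_mono[OF entry[of i k], of 2] by (simp add: power2_eq_square)
  qed
  then have "s 0 * q ^ k \<le> (\<Sum>i<n. (\<Sum>j<n. b * \<bar>x $ j\<bar>)\<^sup>2)" for k
    using growth order_trans by blast
  then have "q ^ k \<le> (\<Sum>i<n. (\<Sum>j<n. b * \<bar>x $ j\<bar>)\<^sup>2) / s 0" for k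
    using s0 by (simp add: field_simps)
  with real_arch_pow[OF q] show False by (meson not_le)
qed

text \<open>For every \<open>c\<close> above \<open>\<rho> H\<close> the matrix \<open>H / c\<close>
  has spectral radius below one, so its Jordan normal form gives a common bound for the entries of
  its powers and the preceding lemma applies. Then \<open>c\<close> decreases to
  \<open>\<rho> H\<close>.\<close>

lemma Rayleigh_quotient_le_spectral_radius:
  fixes H :: "real mat"
  assumes H: "H \<in> carrier_mat n n" and sym: "transpose_mat H = H" and x: "x \<in> carrier_vec n"
    and n: "n > 0"
  shows "x \<bullet> (H *\<^sub>v x) \<le> \<rho> H * (x \<bullet> x)"
proof -
  have *: "x \<bullet> (H *\<^sub>v x) \<le> c * (x \<bullet> x)" if c: "\<rho> H < c" for c
  proof -
    let ?G = "(1 / c) \<cdot>\<^sub>m H"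
    have c0: "c > 0" using spectral_radius_nonneg[of "map_mat complex_of_real H" n] c H n by simp
    have G: "?G \<in> carrier_mat n n" using H by simp
    have "map_mat complex_of_real ?G = of_real (1 / c) \<cdot>\<^sub>m map_mat complex_of_real H"
      by (intro eq_matI) auto
    then have "\<rho> ?G < 1"
      using spectral_radius_smult_less_1[OF _ n c] H by simp
    then obtain b where b: "\<forall>k. norm_bound (map_mat complex_of_real ?G ^\<^sub>m k) b"
      using spectral_radius_jnf_norm_bound_less_1_upper_triangular[of "map_mat complex_of_real ?G" n]
        G by auto
    have "norm_bound (?G ^\<^sub>m k) b" for k
      using b[rule_format, of k] unfolding of_real_hom.mat_hom_pow[OF G, symmetric] norm_bound_def
      by simp
    moreover have "transpose_mat ?G = ?G"
    proof (intro eq_matI)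
      fix i j assume "i < dim_row ?G" "j < dim_col ?G"
      then show "transpose_mat ?G $$ (i,j) = ?G $$ (i,j)"
        using arg_cong[OF sym, of "\<lambda>A. A $$ (i,j)"] H by simp
    qed (use H in auto)
    ultimately have "x \<bullet> (?G *\<^sub>v x) \<le> x \<bullet> x"
      using Rayleigh_quotient_less_1[OF G _ x] by blast
    moreover have "?G *\<^sub>v x = (1 / c) \<cdot>\<^sub>v (H *\<^sub>v x)"
      using H x by (intro eq_vecI) auto
    ultimately have "(1 / c) * (x \<bullet> (H *\<^sub>v x)) \<le> x \<bullet> x"
      using H x by simp
    then show ?thesis using c0 by (simp add: field_simps)
  qed
  show ?thesis
  proof (cases "x \<bullet> x = 0")
    case True
    \<comment> \<open>With \<open>x \<bullet> x = 0\<close> the right-hand side does not depend on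
      \<open>c\<close>, so a single admissible value suffices.\<close>
    then show ?thesis using *[of "\<rho> H + 1"] by simp
  next
    case False
    then have pos: "x \<bullet> x > 0" using scalar_prod_self_nonneg[of x] by linarith
    have "x \<bullet> (H *\<^sub>v x) / (x \<bullet> x) \<le> \<rho> H"
      by (rule dense_ge) (use * pos in \<open>simp add: field_simps\<close>)
    then show ?thesis using pos by (simp add: field_simps)
  qed
qed

section \<open>Row sums of nonnegative matrices\<close>

text \<open>The eigenvalue equation is read at a component \<open>i\<close> where the eigenvector
  has largest modulus. All other components are dominated by this one, which is non-zero and
  cancels, leaving the sum of row \<open>i\<close>.\<close>

lemma spectral_radius_le_Max_row_sum:
  fixes N :: "real mat"
  assumes N: "N \<in> carrier_mat n n" and n: "n > 0" and nonneg: "\<And>i j. i < n \<Longrightarrow> j < n \<Longrightarrow> N $$ (i,j) \<ge> 0"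
  shows "\<rho> N \<le> Max ((\<lambda>i. \<Sum>j<n. N $$ (i,j)) ` {..<n})"
proof -
  obtain k where k: "eigenvalue (map_mat complex_of_real N) k" "\<rho> N = norm k"
    using maximal_modulus_eigenvalueE[of "map_mat complex_of_real N" n] N n by auto
  then obtain v where v: "v \<in> carrier_vec n" "v \<noteq> 0\<^sub>v n"
      and ev: "map_mat complex_of_real N *\<^sub>v v = k \<cdot>\<^sub>v v"
    using N unfolding eigenvalue_def eigenvector_def by auto
  have "Max ((\<lambda>i. norm (v $ i)) ` {..<n}) \<in> (\<lambda>i. norm (v $ i)) ` {..<n}"
    using n by (intro Max_in) auto
  then obtain i where i: "i < n" and "norm (v $ i) = Max ((\<lambda>i. norm (v $ i)) ` {..<n})"
    by auto
  then have max: "norm (v $ j) \<le> norm (v $ i)" if "j < n" for j using that by simp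
  have "v $ i \<noteq> 0"
    using v max by (auto simp: vec_eq_iff)
  have "k * v $ i = (map_mat complex_of_real N *\<^sub>v v) $ i" using ev v i by simp
  also have "\<dots> = (\<Sum>j<n. of_real (N $$ (i,j)) * v $ j)"
    using mult_mat_vec_nth[of "map_mat complex_of_real N" n n v i] N v i by simp
  finally have "norm k * norm (v $ i) = norm (\<Sum>j<n. of_real (N $$ (i,j)) * v $ j)"
    by (metis norm_mult)
  also have "\<dots> \<le> (\<Sum>j<n. N $$ (i,j) * norm (v $ i))"
    using nonneg i max by (intro sum_norm_le) (auto simp: norm_mult intro!: mult_left_mono)
  also have "\<dots> = (\<Sum>j<n. N $$ (i,j)) * norm (v $ i)" by (simp add: sum_distrib_right)
  finally have "norm k \<le> (\<Sum>j<n. N $$ (i,j))" using \<open>v $ i \<noteq> 0\<close> by simp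
  also have "\<dots> \<le> Max ((\<lambda>i. \<Sum>j<n. N $$ (i,j)) ` {..<n})" using i by simp
  finally show ?thesis using k by simp
qed

section \<open>Incidence matrices, their Gram matrices and the convective form\<close>

text \<open>Orients every face from its \<open>-1\<close> cell \<open>q f\<close> to its
  \<open>+1\<close> cell \<open>p f\<close>. The two cells differ because the entries do, which lets
  one formula with indicators describe the whole row.\<close>

lemma incidence_endpoints:
  assumes T: "T \<in> carrier_mat m n" and inc: "cell_to_face_incidence T"
  obtains p q where "\<And>f. f < m \<Longrightarrow> p f < n \<and> q f < n \<and> p f \<noteq> q f"
    and "\<And>f i. f < m \<Longrightarrow> i < n \<Longrightarrow> T $$ (f,i) = of_bool (i = p f) - of_bool (i = q f)"
proof -
  have "\<forall>f. \<exists>j k. f < m \<longrightarrow> j < n \<and> k < n \<and> T $$ (f,j) = 1 \<and> T $$ (f,k) = -1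
      \<and> (\<forall>l<n. l \<noteq> j \<and> l \<noteq> k \<longrightarrow> T $$ (f,l) = 0)"
    using inc T unfolding cell_to_face_incidence_def by blast
  then obtain p q where pq: "\<And>f. f < m \<Longrightarrow> p f < n \<and> q f < n \<and> T $$ (f,p f) = 1
      \<and> T $$ (f,q f) = -1 \<and> (\<forall>l<n. l \<noteq> p f \<and> l \<noteq> q f \<longrightarrow> T $$ (f,l) = 0)"
    by metis
  have ne: "p f \<noteq> q f" if "f < m" for f using pq[OF that] by auto
  show ?thesis
  proof
    show "p f < n \<and> q f < n \<and> p f \<noteq> q f" if "f < m" for f using pq[OF that] ne[OF that] by simp
    show "T $$ (f,i) = of_bool (i = p f) - of_bool (i = q f)" if "f < m" "i < n" for f i
      using pq[OF that(1)] ne[OF that(1)] that(2) by (cases "i = p f"; cases "i = q f") auto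
  qed
qed

lemma mult_diag_transpose_nth:
  fixes A :: "'a :: comm_semiring_1 mat"
  assumes A: "A \<in> carrier_mat m n" and f: "f < m" and g: "g < m"
  shows "(A * mat_diag n w * transpose_mat A) $$ (f,g) = (\<Sum>i<n. A $$ (f,i) * w i * A $$ (g,i))"
proof -
  have At: "transpose_mat A \<in> carrier_mat n m" using A by simp
  show ?thesis
    unfolding mult_mat_nth[OF mult_carrier_mat[OF A mat_diag_dim] At f g]
    unfolding mat_diag_mult_right[OF A]
    using A f g by (intro sum.cong) auto
qed

text \<open>No cancellation occurs: two faces sharing both cells are either parallel or antiparallel.\<close>

lemma abs_incidence_gram:
  assumes T: "T \<in> carrier_mat m n" and inc: "cell_to_face_incidence T"
    and w: "\<And>i. i < n \<Longrightarrow> w i \<ge> 0"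
  shows "abs_mat (T * mat_diag n w * transpose_mat T)
    = abs_mat T * mat_diag n w * transpose_mat (abs_mat T)"
proof (intro eq_matI)
  obtain p q where pq: "\<And>f. f < m \<Longrightarrow> p f < n \<and> q f < n \<and> p f \<noteq> q f"
    and Tpq: "\<And>f i. f < m \<Longrightarrow> i < n \<Longrightarrow> T $$ (f,i) = of_bool (i = p f) - of_bool (i = q f)"
    using incidence_endpoints[OF T inc] by blast
  fix f g
  assume "f < dim_row (abs_mat T * mat_diag n w * transpose_mat (abs_mat T))"
    "g < dim_col (abs_mat T * mat_diag n w * transpose_mat (abs_mat T))"
  then have f: "f < m" and g: "g < m" using T by auto
  let ?t = "\<lambda>i. T $$ (f,i) * w i * T $$ (g,i)"
  have "\<bar>\<Sum>i<n. ?t i\<bar> = (\<Sum>i<n. \<bar>?t i\<bar>)"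
  proof (cases "p f = p g \<or> q f = q g")
    \<comment> \<open>With a common \<open>+1\<close> or a common \<open>-1\<close> cell, no cell is
      the \<open>+1\<close> end of one face and the \<open>-1\<close> end of the other, as this
      would identify the two ends of a single face. So no product is negative.\<close>
    case True
    have "?t i \<ge> 0" if i: "i < n" for i
    proof -
      have "T $$ (f,i) * T $$ (g,i) \<ge> 0"
        unfolding Tpq[OF f i] Tpq[OF g i] using True pq[OF f] pq[OF g]
        by (cases "i = p f"; cases "i = q f"; cases "i = p g"; cases "i = q g") simp_all
      then have "w i * (T $$ (f,i) * T $$ (g,i)) \<ge> 0"
        using w[OF i] by (rule mult_nonneg_nonneg[rotated])
      then show ?thesis by (simp only: mult_ac)
    qed
    then have "(\<Sum>i<n. ?t i) \<ge> 0" and "(\<Sum>i<n. \<bar>?t i\<bar>) = (\<Sum>i<n. ?t i)"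
      by (auto intro!: sum_nonneg sum.cong)
    then show ?thesis by (simp only: abs_of_nonneg)
  next
    \<comment> \<open>Now a shared cell always carries opposite signs, so no product is
      positive.\<close>
    case False
    have "?t i \<le> 0" if i: "i < n" for i
    proof -
      have "T $$ (f,i) * T $$ (g,i) \<le> 0"
        unfolding Tpq[OF f i] Tpq[OF g i] using False pq[OF f] pq[OF g]
        by (cases "i = p f"; cases "i = q f"; cases "i = p g"; cases "i = q g") simp_all
      then have "w i * (T $$ (f,i) * T $$ (g,i)) \<le> 0"
        using w[OF i] by (rule mult_nonneg_nonpos[rotated])
      then show ?thesis by (simp only: mult_ac)
    qed
    then have "(\<Sum>i<n. ?t i) \<le> 0" and "(\<Sum>i<n. \<bar>?t i\<bar>) = (\<Sum>i<n. - ?t i)"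
      by (auto intro!: sum_nonpos sum.cong)
    then show ?thesis by (simp only: abs_of_nonpos sum_negf)
  qed
  also have "\<dots> = (\<Sum>i<n. \<bar>T $$ (f,i)\<bar> * w i * \<bar>T $$ (g,i)\<bar>)"
    using w by (intro sum.cong) (auto simp: abs_mult)
  finally show "abs_mat (T * mat_diag n w * transpose_mat T) $$ (f,g)
      = (abs_mat T * mat_diag n w * transpose_mat (abs_mat T)) $$ (f,g)"
    using T f g mult_diag_transpose_nth[OF T f g] mult_diag_transpose_nth[of "abs_mat T" m n f g w]
    by simp
qed (use T in auto)

text \<open>The terms \<open>\<bar>v\<^sub>p\<bar>\<^sup>2 - \<bar>v\<^sub>q\<bar>\<^sup>2\<close> sum to zero by incompressibility; AM-GM on the remaining cross
  terms gives the factor \<open>1/4\<close>.\<close>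

lemma convective_form_bound:
  fixes F :: "nat \<Rightarrow> real" and v :: "nat \<Rightarrow> complex"
  assumes div_free: "\<And>g :: nat \<Rightarrow> real. (\<Sum>f<m. F f * (g (p f) - g (q f))) = 0"
  shows "norm (1/2 * (\<Sum>f<m. of_real (F f) * ((cnj (v (p f)) - cnj (v (q f))) * (v (p f) + v (q f)))))
    \<le> 1/4 * (\<Sum>f<m. \<bar>F f\<bar> * (norm (v (p f)) + norm (v (q f)))\<^sup>2)"
proof -
  \<comment> \<open>Splits the product into a real part, a difference of values of one cell
    function, and a purely imaginary cross term.\<close>
  have expand: "(cnj a - cnj b) * (a + b)
      = of_real ((norm a)\<^sup>2 - (norm b)\<^sup>2) + (cnj a * b - cnj b * a)" for a b :: complex
    unfolding of_real_diff complex_norm_square by (simp add: algebra_simps)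
  let ?c = "\<lambda>f. of_real (F f) * (cnj (v (p f)) * v (q f) - cnj (v (q f)) * v (p f))"
  have "(\<Sum>f<m. of_real (F f) * ((cnj (v (p f)) - cnj (v (q f))) * (v (p f) + v (q f))))
    = (\<Sum>f<m. of_real (F f * ((norm (v (p f)))\<^sup>2 - (norm (v (q f)))\<^sup>2)) + ?c f)"
    unfolding expand by (simp only: of_real_mult distrib_left)
  also have "\<dots> = of_real (\<Sum>f<m. F f * ((norm (v (p f)))\<^sup>2 - (norm (v (q f)))\<^sup>2)) + (\<Sum>f<m. ?c f)"
    by (simp only: sum.distrib of_real_sum)
  also have "(\<Sum>f<m. F f * ((norm (v (p f)))\<^sup>2 - (norm (v (q f)))\<^sup>2)) = 0"
    using div_free[of "\<lambda>i. (norm (v i))\<^sup>2"] .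
  finally have eq: "(\<Sum>f<m. of_real (F f) * ((cnj (v (p f)) - cnj (v (q f))) * (v (p f) + v (q f))))
    = (\<Sum>f<m. ?c f)" by simp
  have "norm (\<Sum>f<m. ?c f) \<le> (\<Sum>f<m. 1/2 * (\<bar>F f\<bar> * (norm (v (p f)) + norm (v (q f)))\<^sup>2))"
  proof (rule sum_norm_le)
    fix f
    let ?a = "norm (v (p f))" and ?b = "norm (v (q f))"
    have "norm (cnj (v (p f)) * v (q f) - cnj (v (q f)) * v (p f)) \<le> 2 * (?a * ?b)"
      using norm_triangle_ineq4[of "cnj (v (p f)) * v (q f)" "cnj (v (q f)) * v (p f)"]
      by (simp add: norm_mult)
    \<comment> \<open>This is \<open>4 * a * b \<le> (a + b)\<^sup>2\<close>. The factor
      \<open>1/2\<close> obtained here and the \<open>1/2\<close> in the definition of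
      \<open>C\<close> make up the final \<open>1/4\<close>.\<close>
    also have "\<dots> \<le> 1/2 * (?a + ?b)\<^sup>2"
      using zero_le_power2[of "?a - ?b"] by (simp add: power2_eq_square algebra_simps)
    finally have "\<bar>F f\<bar> * norm (cnj (v (p f)) * v (q f) - cnj (v (q f)) * v (p f))
        \<le> \<bar>F f\<bar> * (1/2 * (?a + ?b)\<^sup>2)"
      by (rule mult_left_mono) simp
    then show "norm (?c f) \<le> 1/2 * (\<bar>F f\<bar> * (?a + ?b)\<^sup>2)"
      by (simp add: norm_mult)
  qed
  then have "norm (\<Sum>f<m. ?c f)
      \<le> 1/2 * (\<Sum>f<m. \<bar>F f\<bar> * (norm (v (p f)) + norm (v (q f)))\<^sup>2)"
    by (simp only: sum_distrib_left)
  then show ?thesis unfolding eq norm_mult by simp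
qed

section \<open>Splitting the flux weights with the exponent \<alpha>\<close>

text \<open>The exponents add up to 1, so the convention \<open>0^0 = 1\<close> affects at most one
  of the two factors; at \<open>x = 0\<close> the other one still makes the product vanish.\<close>

lemma diag_powr_mult:
  assumes "\<alpha> < 0 \<or> \<alpha> > 1 \<longrightarrow> x \<noteq> 0"
  shows "(if 1 - \<alpha> = 0 then 1 else \<bar>x\<bar> powr (1 - \<alpha>)) * (if \<alpha> = 0 then 1 else \<bar>x\<bar> powr \<alpha>)
    = \<bar>x :: real\<bar>"
proof (cases "x = 0")
  case True
  then have "0 \<le> \<alpha>" "\<alpha> \<le> 1" using assms by auto
  then show ?thesis using True by auto
next
  case False
  have "\<bar>x\<bar> powr (1 - \<alpha>) * \<bar>x\<bar> powr \<alpha> = \<bar>x\<bar>"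
    using False unfolding powr_add[symmetric] by simp
  then show ?thesis using False by (cases "\<alpha> = 0"; cases "\<alpha> = 1") simp_all
qed

text \<open>Cyclic permutation brings the last factor to the front, where the two powers of
  \<open>|F|\<close> merge. Hence the middle term of the theorem has the same value for every
  admissible \<alpha>.\<close>

lemma spectral_radius_diag_powr:
  fixes M :: "real mat"
  assumes F: "F \<in> carrier_mat m m" and M: "M \<in> carrier_mat m m" and m: "m > 0"
    and nz: "\<alpha> < 0 \<or> \<alpha> > 1 \<longrightarrow> (\<forall>j<m. F $$ (j,j) \<noteq> 0)"
  shows "\<rho> (abs_diag_powr F \<alpha> * M * abs_diag_powr F (1 - \<alpha>))
    = \<rho> (mat_diag m (\<lambda>j. \<bar>F $$ (j,j)\<bar>) * M)"
proof -
  let ?A = "abs_diag_powr F \<alpha>" and ?B = "abs_diag_powr F (1 - \<alpha>)"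
  have A: "?A \<in> carrier_mat m m" and B: "?B \<in> carrier_mat m m"
    using F by (auto simp: abs_diag_powr_def)
  have "?B * ?A = mat_diag m (\<lambda>j. \<bar>F $$ (j,j)\<bar>)"
  proof -
    have "dim_row F = m" using F by simp
    then have BA: "?B * ?A = mat_diag m (\<lambda>j.
        (if 1 - \<alpha> = 0 then 1 else \<bar>F $$ (j,j)\<bar> powr (1 - \<alpha>)) *
        (if \<alpha> = 0 then 1 else \<bar>F $$ (j,j)\<bar> powr \<alpha>))"
      by (simp only: abs_diag_powr_def mat_diag_diag)
    have "\<alpha> < 0 \<or> \<alpha> > 1 \<longrightarrow> F $$ (j,j) \<noteq> 0" if "j < m" for j
      using nz that by blast
    from diag_powr_mult[OF this] show ?thesis
      unfolding BA mat_diag_def by (intro cong_mat refl) (auto simp only: split_conv)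
  qed
  moreover have "\<rho> (?A * M * ?B) = \<rho> (?B * (?A * M))"
    using A B M m by (intro real_spectral_radius_mult_commute[of _ m m]) auto
  moreover have "?B * (?A * M) = ?B * ?A * M"
    using assoc_mult_mat[OF B A M] ..
  ultimately show ?thesis by simp
qed

section \<open>Energy estimate for eigenvectors of the convective operator\<close>

text \<open>A row of \<open>T\<close> acts as a difference across the face, a row of
  \<open>|T|\<close> as the sum of both sides. The field is left general because the rules serve
  complex eigenvectors as well as real cell functions such as moduli.\<close>

lemma incidence_row_sums:
  fixes t :: "nat \<Rightarrow> real" and g :: "nat \<Rightarrow> 'a :: real_field"
  assumes t: "\<And>i. i < n \<Longrightarrow> t i = of_bool (i = p) - of_bool (i = q)"
    and p: "p < n" and q: "q < n" and pq: "p \<noteq> q"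
  shows "(\<Sum>i<n. of_real (t i) * g i) = g p - g q"
    and "(\<Sum>i<n. of_real \<bar>t i\<bar> * g i) = g p + g q"
proof -
  have "(\<Sum>i<n. of_real (t i) * g i) = (\<Sum>i<n. (if i = p then g i else 0) - (if i = q then g i else 0))"
    by (intro sum.cong) (auto simp: t)
  then show "(\<Sum>i<n. of_real (t i) * g i) = g p - g q"
    using p q by (simp add: sum_subtractf)
  have "(\<Sum>i<n. of_real \<bar>t i\<bar> * g i) = (\<Sum>i<n. (if i = p then g i else 0) + (if i = q then g i else 0))"
    using pq by (intro sum.cong) (auto simp: t)
  then show "(\<Sum>i<n. of_real \<bar>t i\<bar> * g i) = g p + g q"
    using p q by (simp add: sum.distrib)
qed

lemma diag_vec_nth:
  assumes "A \<in> carrier_mat m n" and "i < m"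
  shows "diag_vec A $ i = A $$ (i,i)"
  unfolding vec_of_list_index using assms by (simp add: diag_mat_def)

text \<open>Hypothesis \<open>ev\<close> is the generalised eigenvalue problem
  \<open>C v = k \<Omega> v\<close>, with \<open>C\<close> expanded over the faces. Pairing it with
  the conjugate of \<open>v\<close> gives \<open>k\<close> times a nonnegative energy on one side
  and the form treated by \<open>convective_form_bound\<close> on the other.\<close>

lemma eigenvalue_convective_le:
  fixes T F :: "real mat" and \<omega> :: "nat \<Rightarrow> real" and k :: complex
  assumes T: "T \<in> carrier_mat m n" and inc: "cell_to_face_incidence T"
    and \<omega>: "\<And>i. i < n \<Longrightarrow> \<omega> i > 0"
    and F: "F \<in> carrier_mat m m"
    and ker: "diag_vec F \<in> mat_kernel (transpose_mat T)"
    and ev: "\<And>i. i < n \<Longrightarrow>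
      (\<Sum>j<n. of_real (1/2 * (\<Sum>f<m. T $$ (f,i) * F $$ (f,f) * \<bar>T $$ (f,j)\<bar>)) * v $ j)
        = k * of_real (\<omega> i) * v $ i"
  shows "norm k * (\<Sum>i<n. \<omega> i * (norm (v $ i))\<^sup>2)
    \<le> 1/4 * (\<Sum>f<m. \<bar>F $$ (f,f)\<bar> * (\<Sum>i<n. \<bar>T $$ (f,i)\<bar> * norm (v $ i))\<^sup>2)"
proof -
  obtain p q where pq: "\<And>f. f < m \<Longrightarrow> p f < n \<and> q f < n \<and> p f \<noteq> q f"
    and Tpq: "\<And>f i. f < m \<Longrightarrow> i < n \<Longrightarrow> T $$ (f,i) = of_bool (i = p f) - of_bool (i = q f)"
    using incidence_endpoints[OF T inc] by blast
  note rows = incidence_row_sums[OF Tpq conjunct1[OF pq] conjunct1[OF conjunct2[OF pq]]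
    conjunct2[OF conjunct2[OF pq]]]
  have div: "(\<Sum>f<m. T $$ (f,i) * F $$ (f,f)) = 0" if i: "i < n" for i
  proof -
    have "diag_vec F $ f = F $$ (f,f)" if "f < m" for f
      using diag_vec_nth[OF F that] .
    moreover have "(transpose_mat T *\<^sub>v diag_vec F) $ i = 0" "diag_vec F \<in> carrier_vec m"
      using ker T i by (auto simp: mat_kernel_def)
    ultimately show ?thesis
      using mult_mat_vec_nth[of "transpose_mat T" n m "diag_vec F" i] T i by simp
  qed
  \<comment> \<open>Discrete summation by parts: the kernel condition is tested against an arbitrary
    cell function \<open>g\<close>. The case needed later is the squared modulus of
    \<open>v\<close>.\<close>
  have div_free: "(\<Sum>f<m. F $$ (f,f) * (g (p f) - g (q f))) = 0" for g :: "nat \<Rightarrow> real"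
  proof -
    have "(\<Sum>f<m. F $$ (f,f) * (g (p f) - g (q f)))
        = (\<Sum>f<m. \<Sum>i<n. F $$ (f,f) * (T $$ (f,i) * g i))"
      unfolding sum_distrib_left[symmetric] using rows(1)[where g = g]
      by (intro sum.cong refl) simp
    also have "\<dots> = (\<Sum>i<n. (\<Sum>f<m. T $$ (f,i) * F $$ (f,f)) * g i)"
      by (subst sum.swap) (simp add: sum_distrib_left sum_distrib_right mult_ac)
    also have "\<dots> = 0" by (simp add: div)
    finally show ?thesis .
  qed
  let ?S = "\<Sum>f<m. of_real (F $$ (f,f)) *
    ((cnj (v $ p f) - cnj (v $ q f)) * (v $ p f + v $ q f))"
  have "k * of_real (\<Sum>i<n. \<omega> i * (norm (v $ i))\<^sup>2) = (\<Sum>i<n. cnj (v $ i) * (k * of_real (\<omega> i) * v $ i))"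
    unfolding of_real_sum of_real_mult complex_norm_square sum_distrib_left
    by (simp only: mult_ac)
  also have "\<dots> = (\<Sum>i<n. cnj (v $ i) *
      (\<Sum>j<n. of_real (1/2 * (\<Sum>f<m. T $$ (f,i) * F $$ (f,f) * \<bar>T $$ (f,j)\<bar>)) * v $ j))"
    by (intro sum.cong refl) (simp only: ev lessThan_iff)
  also have "\<dots> = (\<Sum>i<n. \<Sum>j<n. \<Sum>f<m. 1/2 * (of_real (F $$ (f,f)) *
      ((of_real (T $$ (f,i)) * cnj (v $ i)) * (of_real \<bar>T $$ (f,j)\<bar> * v $ j))))"
    unfolding of_real_mult of_real_sum sum_distrib_left sum_distrib_right
    by (simp add: mult_ac)
  \<comment> \<open>With the face sum outermost, the two cell sums separate into a product, and each
    collapses to the values at the two ends of the face.\<close>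
  also have "\<dots> = (\<Sum>f<m. \<Sum>i<n. \<Sum>j<n. 1/2 * (of_real (F $$ (f,f)) *
      ((of_real (T $$ (f,i)) * cnj (v $ i)) * (of_real \<bar>T $$ (f,j)\<bar> * v $ j))))"
    by (subst (2) sum.swap, subst sum.swap) (rule refl)
  also have "\<dots> = (\<Sum>f<m. 1/2 * (of_real (F $$ (f,f)) *
      ((\<Sum>i<n. of_real (T $$ (f,i)) * cnj (v $ i)) * (\<Sum>j<n. of_real \<bar>T $$ (f,j)\<bar> * v $ j))))"
    unfolding sum_product
    unfolding sum_distrib_left ..
  also have "\<dots> = 1/2 * ?S"
    by (subst sum_distrib_left, intro sum.cong refl) (simp only: rows lessThan_iff)
  finally have eq: "k * of_real (\<Sum>i<n. \<omega> i * (norm (v $ i))\<^sup>2) = 1/2 * ?S" .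
  have "(\<Sum>i<n. \<omega> i * (norm (v $ i))\<^sup>2) \<ge> 0"
    using \<omega> by (intro sum_nonneg) (simp add: less_imp_le)
  then have "norm k * (\<Sum>i<n. \<omega> i * (norm (v $ i))\<^sup>2)
      = norm (k * of_real (\<Sum>i<n. \<omega> i * (norm (v $ i))\<^sup>2))"
    by (simp only: norm_mult norm_of_real abs_of_nonneg)
  also have "\<dots> \<le> 1/4 * (\<Sum>f<m. \<bar>F $$ (f,f)\<bar> * (norm (v $ p f) + norm (v $ q f))\<^sup>2)"
    unfolding eq by (rule convective_form_bound[where F = "\<lambda>f. F $$ (f,f)" and v = "\<lambda>i. v $ i"]) (rule div_free)
  also have "(\<Sum>f<m. \<bar>F $$ (f,f)\<bar> * (norm (v $ p f) + norm (v $ q f))\<^sup>2)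
      = (\<Sum>f<m. \<bar>F $$ (f,f)\<bar> * (\<Sum>i<n. \<bar>T $$ (f,i)\<bar> * norm (v $ i))\<^sup>2)"
    by (intro sum.cong refl) (use rows(2)[where g = "\<lambda>i. norm (v $ i)"] in simp)
  finally show ?thesis .
qed

section \<open>Weighted Gram matrices as symmetric quadratic forms\<close>

text \<open>Obtained by moving the transpose of \<open>G\<close> across the scalar product. It
  identifies the face sum of the energy estimate as the quadratic form of a symmetric cell matrix,
  to which the Rayleigh bound applies.\<close>

lemma weighted_gram_form:
  fixes G :: "real mat"
  assumes G: "G \<in> carrier_mat m n" and y: "y \<in> carrier_vec n"
  shows "y \<bullet> (transpose_mat G * (mat_diag m d * G) *\<^sub>v y) = (\<Sum>f<m. d f * ((G *\<^sub>v y) $ f)\<^sup>2)"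
proof -
  let ?P = "mat_diag m d"
  have Gy: "G *\<^sub>v y \<in> carrier_vec m" using G y by simp
  have PGy: "?P *\<^sub>v (G *\<^sub>v y) \<in> carrier_vec m"
    using mult_mat_vec_carrier[OF mat_diag_dim Gy] .
  have PG: "?P * G \<in> carrier_mat m n" using mult_carrier_mat[OF mat_diag_dim G] .
  have "transpose_mat G * (?P * G) *\<^sub>v y = transpose_mat G *\<^sub>v (?P * G *\<^sub>v y)"
    using G y PG by (intro assoc_mult_mat_vec[of _ n m _ n]) auto
  also have "?P * G *\<^sub>v y = ?P *\<^sub>v (G *\<^sub>v y)"
    using assoc_mult_mat_vec[OF mat_diag_dim G y] .
  finally have "y \<bullet> (transpose_mat G * (?P * G) *\<^sub>v y)
      = (transpose_mat G *\<^sub>v (?P *\<^sub>v (G *\<^sub>v y))) \<bullet> y"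
    using G y PGy by (simp add: comm_scalar_prod[of y n])
  also have "\<dots> = (?P *\<^sub>v (G *\<^sub>v y)) \<bullet> (G *\<^sub>v y)"
    by (rule transpose_vec_mult_scalar[OF G y PGy])
  also have "\<dots> = (\<Sum>f<m. (?P *\<^sub>v (G *\<^sub>v y)) $ f * (G *\<^sub>v y) $ f)"
    using G unfolding scalar_prod_def atLeast0LessThan by simp
  also have "\<dots> = (\<Sum>f<m. d f * ((G *\<^sub>v y) $ f)\<^sup>2)"
  proof (intro sum.cong refl)
    fix f assume "f \<in> {..<m}"
    then have f: "f < m" by simp
    have "(?P *\<^sub>v (G *\<^sub>v y)) $ f = (\<Sum>g<m. ?P $$ (f,g) * (G *\<^sub>v y) $ g)"
      using mult_mat_vec_nth[OF mat_diag_dim Gy f] .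
    also have "\<dots> = (\<Sum>g<m. if f = g then d g * (G *\<^sub>v y) $ g else 0)"
      using f by (intro sum.cong) (auto simp: mat_diag_def)
    also have "\<dots> = d f * (G *\<^sub>v y) $ f" using f by simp
    finally show "(?P *\<^sub>v (G *\<^sub>v y)) $ f * (G *\<^sub>v y) $ f = d f * ((G *\<^sub>v y) $ f)\<^sup>2"
      by (simp add: power2_eq_square)
  qed
  finally show ?thesis .
qed

lemma symmetric_weighted_gram:
  fixes G :: "real mat"
  assumes G: "G \<in> carrier_mat m n"
  shows "transpose_mat (transpose_mat G * (mat_diag m d * G)) = transpose_mat G * (mat_diag m d * G)"
proof -
  have "transpose_mat (mat_diag m d) = mat_diag m d"
    by (intro eq_matI) (auto simp: mat_diag_def)
  then have "transpose_mat (mat_diag m d * G) = transpose_mat G * mat_diag m d"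
    using transpose_mult[of "mat_diag m d" m m G n] G by simp
  then have "transpose_mat (transpose_mat G * (mat_diag m d * G)) = transpose_mat G * mat_diag m d * G"
    using transpose_mult[of "transpose_mat G" n m "mat_diag m d * G" n] G
      mult_carrier_mat[OF mat_diag_dim G] by simp
  also have "\<dots> = transpose_mat G * (mat_diag m d * G)"
    using G by (intro assoc_mult_mat[of _ n m _ m _ n]) auto
  finally show ?thesis .
qed

text \<open>The components of the Hadamard product are exactly the row sums of the triple product:
  the left weight is constant along a row, the right weight is summed against \<open>M\<close>. All
  entries are nonnegative, so the row-sum bound applies.\<close>

lemma spectral_radius_diag_powr_le_Max:
  fixes M :: "real mat"
  assumes F: "F \<in> carrier_mat m m" and M: "M \<in> carrier_mat m m" and m: "m > 0"
    and nonneg: "\<And>i j. i < m \<Longrightarrow> j < m \<Longrightarrow> M $$ (i,j) \<ge> 0"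
  shows "\<rho> (abs_diag_powr F \<alpha> * M * abs_diag_powr F (1 - \<alpha>))
    \<le> Max (set\<^sub>v (component_mult (diag_vec (abs_diag_powr F \<alpha>)) (M *\<^sub>v diag_vec (abs_diag_powr F (1 - \<alpha>)))))"
proof -
  let ?N = "abs_diag_powr F \<alpha> * M * abs_diag_powr F (1 - \<alpha>)"
  define d where "d \<beta> j = (if \<beta> = 0 then 1 else \<bar>F $$ (j,j)\<bar> powr \<beta>)" for \<beta> :: real and j
  have d: "abs_diag_powr F \<beta> = mat_diag m (d \<beta>)" for \<beta>
    using F by (simp add: abs_diag_powr_def d_def[abs_def])
  have d_nonneg: "d \<beta> j \<ge> 0" for \<beta> j by (simp add: d_def)
  have dv: "diag_vec (abs_diag_powr F \<beta>) = vec m (d \<beta>)" for \<beta>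
  proof (intro eq_vecI)
    show "dim_vec (diag_vec (abs_diag_powr F \<beta>)) = dim_vec (vec m (d \<beta>))"
      unfolding d by (simp add: diag_mat_def mat_diag_def)
    fix i assume "i < dim_vec (vec m (d \<beta>))"
    then show "diag_vec (abs_diag_powr F \<beta>) $ i = vec m (d \<beta>) $ i"
      unfolding d by (subst diag_vec_nth[OF mat_diag_dim]) (simp_all add: mat_diag_def)
  qed
  have dM: "mat_diag m (d \<alpha>) * M \<in> carrier_mat m m" using mult_carrier_mat[OF mat_diag_dim M] .
  have N: "?N \<in> carrier_mat m m" unfolding d using mult_carrier_mat[OF dM mat_diag_dim] .
  have N_nth: "?N $$ (i,j) = d \<alpha> i * M $$ (i,j) * d (1 - \<alpha>) j" if "i < m" "j < m" for i j
    unfolding d mat_diag_mult_right[OF dM]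
    unfolding mat_diag_mult_left[OF M] using that by simp
  have N_nonneg: "?N $$ (i,j) \<ge> 0" if "i < m" "j < m" for i j
    unfolding N_nth[OF that] using nonneg[OF that] d_nonneg by (intro mult_nonneg_nonneg)
  have "component_mult (vec m (d \<alpha>)) (M *\<^sub>v vec m (d (1 - \<alpha>))) $ i = (\<Sum>j<m. ?N $$ (i,j))"
    if i: "i < m" for i
  proof -
    have dim: "dim_vec (M *\<^sub>v vec m (d (1 - \<alpha>))) = m" using M by (metis carrier_matD(1) dim_mult_mat_vec)
    have "component_mult (vec m (d \<alpha>)) (M *\<^sub>v vec m (d (1 - \<alpha>))) $ i
        = d \<alpha> i * (M *\<^sub>v vec m (d (1 - \<alpha>))) $ i"
      using i dim by (subst index_component_mult) simp_all
    also have "\<dots> = d \<alpha> i * (\<Sum>j<m. M $$ (i,j) * vec m (d (1 - \<alpha>)) $ j)"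
      using mult_mat_vec_nth[OF M vec_carrier i] by simp
    also have "\<dots> = (\<Sum>j<m. ?N $$ (i,j))"
      unfolding sum_distrib_left by (intro sum.cong refl) (simp add: N_nth[OF i] mult.assoc del: index_mult_mat(1))
    finally show ?thesis .
  qed
  moreover have "dim_vec (component_mult (vec m (d \<alpha>)) (M *\<^sub>v vec m (d (1 - \<alpha>)))) = m"
    using M by (simp add: dim_component_mult)
  ultimately have "set\<^sub>v (component_mult (vec m (d \<alpha>)) (M *\<^sub>v vec m (d (1 - \<alpha>))))
      = (\<lambda>i. \<Sum>j<m. ?N $$ (i,j)) ` {..<m}"
    unfolding vec_set_def by (intro image_cong) auto
  then show ?thesis
    unfolding dv using spectral_radius_le_Max_row_sum[OF N m N_nonneg] by simp
qed

section \<open>Both bounds for the convective operator\<close>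

theorem mainTheorem1:
  fixes m n :: nat and T \<Omega> F C :: "real mat" and \<alpha> :: real
  assumes "m > 0"
    and "T \<in> carrier_mat m n" and "cell_to_face_incidence T"
    and "\<Omega> \<in> carrier_mat n n" and "diagonal_mat \<Omega>" and "\<forall>i<n. \<Omega> $$ (i,i) > 0"
    and "F \<in> carrier_mat m m" and "diagonal_mat F"
    and "diag_vec F \<in> mat_kernel (transpose_mat T)"
    and "C = (1/2) \<cdot>\<^sub>m (transpose_mat T * F * abs_mat T)"
    and "\<alpha> < 0 \<or> \<alpha> > 1 \<longrightarrow> (\<forall>j<m. F $$ (j,j) \<noteq> 0)"
  shows "\<rho> (mat_inv \<Omega> * C)
           \<le> 1/4 * \<rho> (abs_diag_powr F \<alpha> * abs_mat (T * mat_inv \<Omega> * transpose_mat T)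
                        * abs_diag_powr F (1 - \<alpha>))
       \<and> 1/4 * \<rho> (abs_diag_powr F \<alpha> * abs_mat (T * mat_inv \<Omega> * transpose_mat T)
                        * abs_diag_powr F (1 - \<alpha>))
           \<le> 1/4 * Max (set\<^sub>v (component_mult (diag_vec (abs_diag_powr F \<alpha>))
                 (abs_mat (T * mat_inv \<Omega> * transpose_mat T) *\<^sub>v diag_vec (abs_diag_powr F (1 - \<alpha>)))))"
proof
  note m = \<open>m > 0\<close> and T = \<open>T \<in> carrier_mat m n\<close> and inc = \<open>cell_to_face_incidence T\<close>
    and F = \<open>F \<in> carrier_mat m m\<close>
  let ?M = "abs_mat (T * mat_inv \<Omega> * transpose_mat T)"
  let ?w = "\<lambda>i. 1 / \<Omega> $$ (i,i)"
  let ?N = "abs_diag_powr F \<alpha> * ?M * abs_diag_powr F (1 - \<alpha>)"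
  have \<omega>: "\<Omega> $$ (i,i) > 0" if "i < n" for i using assms that by blast
  have inv: "mat_inv \<Omega> = mat_diag n ?w"
    using mat_inverse_diagonal[OF assms(4,5)] \<omega> by (metis less_irrefl option.sel)
  have M: "?M \<in> carrier_mat m m"
    unfolding inv using mult_carrier_mat[OF mult_carrier_mat[OF T mat_diag_dim], of "transpose_mat T" m] T
    by simp
  have M_nonneg: "?M $$ (i,j) \<ge> 0" if "i < m" "j < m" for i j
    using index_map_mat(1)[of i "T * mat_inv \<Omega> * transpose_mat T" j abs] M that
    by (simp only: map_carrier_mat carrier_matD abs_ge_zero)
  \<comment> \<open>There is a face, and its adjacent cells make \<open>n\<close> positive; this
    guarantees a non-empty spectrum for the cell matrices.\<close>
  have n: "n > 0"
    using inc T m unfolding cell_to_face_incidence_def by fastforce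
  show "\<rho> (mat_inv \<Omega> * C) \<le> 1/4 * \<rho> ?N"
  proof -
    \<comment> \<open>The square root splits the inverse volumes evenly, so that one factor
      \<open>G\<close> yields both the symmetric cell matrix \<open>?H\<close> and, as
      \<open>G * transpose_mat G\<close>, the face matrix \<open>?M\<close>.\<close>
    define G where "G = abs_mat T * mat_diag n (\<lambda>i. 1 / sqrt (\<Omega> $$ (i,i)))"
    let ?P = "mat_diag m (\<lambda>f. \<bar>F $$ (f,f)\<bar>)"
    let ?H = "transpose_mat G * (?P * G)"
    have absT: "abs_mat T \<in> carrier_mat m n" using T by simp
    have G: "G \<in> carrier_mat m n" using mult_carrier_mat[OF absT mat_diag_dim] by (simp add: G_def)
    then have Gt: "transpose_mat G \<in> carrier_mat n m" by simp
    have PG: "?P * G \<in> carrier_mat m n" using mult_carrier_mat[OF mat_diag_dim G] .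
    have G_nth: "G $$ (f,i) = \<bar>T $$ (f,i)\<bar> / sqrt (\<Omega> $$ (i,i))" if "f < m" "i < n" for f i
      using that T unfolding G_def mat_diag_mult_right[OF absT] by simp
    have GG: "G * transpose_mat G = ?M"
    proof -
      have "?M = abs_mat T * mat_diag n ?w * transpose_mat (abs_mat T)"
        unfolding inv using \<omega> by (intro abs_incidence_gram[OF T inc]) (simp add: less_imp_le)
      also have "\<dots> = G * transpose_mat G"
      proof (intro eq_matI)
        fix f g assume "f < dim_row (G * transpose_mat G)" "g < dim_col (G * transpose_mat G)"
        then have f: "f < m" and g: "g < m" using G by auto
        have "(abs_mat T * mat_diag n ?w * transpose_mat (abs_mat T)) $$ (f,g)
            = (\<Sum>i<n. \<bar>T $$ (f,i)\<bar> * ?w i * \<bar>T $$ (g,i)\<bar>)"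
          unfolding mult_diag_transpose_nth[OF absT f g] using T f g by simp
        also have "\<dots> = (\<Sum>i<n. G $$ (f,i) * G $$ (g,i))"
          by (intro sum.cong refl) (use f g \<omega> in \<open>auto simp: G_nth less_imp_le\<close>)
        also have "\<dots> = (G * transpose_mat G) $$ (f,g)"
          unfolding mult_mat_nth[OF G Gt f g] using G g by simp
        finally show "(abs_mat T * mat_diag n ?w * transpose_mat (abs_mat T)) $$ (f,g)
            = (G * transpose_mat G) $$ (f,g)" .
      qed (use T G in auto)
      finally show ?thesis ..
    qed
    \<comment> \<open>Passes from the \<open>n\<close> by \<open>n\<close> matrix of the Rayleigh
      bound to the \<open>m\<close> by \<open>m\<close> matrix of the theorem.\<close>
    have "\<rho> ?H = \<rho> (?P * G * transpose_mat G)"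
      using Gt PG n m by (intro real_spectral_radius_mult_commute)
    also have "?P * G * transpose_mat G = ?P * ?M"
      using assoc_mult_mat[OF mat_diag_dim G Gt] GG by simp
    also have "\<rho> (?P * ?M) = \<rho> ?N"
      using spectral_radius_diag_powr[OF F M m assms(11)] ..
    finally have rho_H: "\<rho> ?H = \<rho> ?N" .
    have H: "?H \<in> carrier_mat n n" using mult_carrier_mat[OF Gt PG] .
    have TtF: "transpose_mat T * F \<in> carrier_mat n m" using T F by simp
    have C: "C \<in> carrier_mat n n" using T F assms(10) by simp
    have C_nth: "C $$ (i,j) = 1/2 * (\<Sum>f<m. T $$ (f,i) * F $$ (f,f) * \<bar>T $$ (f,j)\<bar>)"
      if i: "i < n" and j: "j < n" for i j
    proof -
      have "F = mat_diag m (\<lambda>f. F $$ (f,f))"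
        using F assms(8) by (intro eq_matI) (auto simp: mat_diag_def diagonal_mat_def)
      then have "(transpose_mat T * F) $$ (i,f) = T $$ (f,i) * F $$ (f,f)" if "f < m" for f
        using mat_diag_mult_right[of "transpose_mat T" n m "\<lambda>f. F $$ (f,f)"] T i that by simp
      then have "(transpose_mat T * F * abs_mat T) $$ (i,j)
          = (\<Sum>f<m. T $$ (f,i) * F $$ (f,f) * \<bar>T $$ (f,j)\<bar>)"
        unfolding mult_mat_nth[OF TtF absT i j] using T j by (intro sum.cong) auto
      then show ?thesis
        using i j T F by (simp add: assms(10) del: index_mult_mat(1))
    qed
    have A: "mat_inv \<Omega> * C \<in> carrier_mat n n" using mult_carrier_mat[OF mat_diag_dim C] by (simp add: inv)
    have cA: "map_mat complex_of_real (mat_inv \<Omega> * C) \<in> carrier_mat n n"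
      using A by (simp only: map_carrier_mat)
    have A_nth: "map_mat complex_of_real (mat_inv \<Omega> * C) $$ (i,j) = of_real (C $$ (i,j) / \<Omega> $$ (i,i))"
      if "i < n" "j < n" for i j
      using that by (simp add: inv mat_diag_mult_left[OF C])
    obtain k where k: "eigenvalue (map_mat complex_of_real (mat_inv \<Omega> * C)) k" "\<rho> (mat_inv \<Omega> * C) = norm k"
      using maximal_modulus_eigenvalueE[OF cA n] by auto
    then obtain v where v: "v \<in> carrier_vec n" "v \<noteq> 0\<^sub>v n"
        and eig: "map_mat complex_of_real (mat_inv \<Omega> * C) *\<^sub>v v = k \<cdot>\<^sub>v v"
      using A unfolding eigenvalue_def eigenvector_def by auto
    \<comment> \<open>Multiplying row \<open>i\<close> by its cell volume removes the inverse of
      \<open>\<Omega>\<close> and gives the form required by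
      \<open>eigenvalue_convective_le\<close>.\<close>
    have ev: "(\<Sum>j<n. of_real (1/2 * (\<Sum>f<m. T $$ (f,i) * F $$ (f,f) * \<bar>T $$ (f,j)\<bar>)) * v $ j)
        = k * of_real (\<Omega> $$ (i,i)) * v $ i" if i: "i < n" for i
    proof -
      have "k * v $ i = (map_mat complex_of_real (mat_inv \<Omega> * C) *\<^sub>v v) $ i"
        using eig v i by simp
      also have "\<dots> = (\<Sum>j<n. of_real (C $$ (i,j) / \<Omega> $$ (i,i)) * v $ j)"
        unfolding mult_mat_vec_nth[OF cA v(1) i]
        by (intro sum.cong refl) (simp only: A_nth[OF i] lessThan_iff)
      also have "\<dots> = (\<Sum>j<n. of_real (C $$ (i,j)) * v $ j) / of_real (\<Omega> $$ (i,i))"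
        by (simp add: sum_divide_distrib)
      finally have "(\<Sum>j<n. of_real (C $$ (i,j)) * v $ j) = k * of_real (\<Omega> $$ (i,i)) * v $ i"
        using \<omega>[OF i] by (simp add: field_simps)
      then show ?thesis using i by (simp add: C_nth)
    qed
    \<comment> \<open>The weights are chosen to cancel: \<open>y \<bullet> y\<close> is the
      \<open>\<Omega>\<close>-energy of \<open>v\<close>, and \<open>G\<close> maps \<open>y\<close>
      to \<open>|T|\<close> applied to the moduli of \<open>v\<close>. The energy estimate thus
      bounds \<open>norm k\<close> by a quarter of the Rayleigh quotient of \<open>?H\<close> at
      \<open>y\<close>.\<close>
    define y where "y = vec n (\<lambda>i. sqrt (\<Omega> $$ (i,i)) * norm (v $ i))"
    have y: "y \<in> carrier_vec n" by (simp add: y_def)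
    have yy: "y \<bullet> y = (\<Sum>i<n. \<Omega> $$ (i,i) * (norm (v $ i))\<^sup>2)"
    proof -
      have "y \<bullet> y = (\<Sum>i<n. (sqrt (\<Omega> $$ (i,i)) * norm (v $ i))\<^sup>2)"
        by (simp add: y_def scalar_prod_def atLeast0LessThan power2_eq_square)
      also have "\<dots> = (\<Sum>i<n. \<Omega> $$ (i,i) * (norm (v $ i))\<^sup>2)"
        by (intro sum.cong refl) (use \<omega> in \<open>simp add: power_mult_distrib less_imp_le\<close>)
      finally show ?thesis .
    qed
    have Gy: "(G *\<^sub>v y) $ f = (\<Sum>i<n. \<bar>T $$ (f,i)\<bar> * norm (v $ i))" if f: "f < m" for f
      unfolding mult_mat_vec_nth[OF G y f]
    proof (intro sum.cong refl)
      fix i assume "i \<in> {..<n}"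
      then have i: "i < n" by simp
      show "G $$ (f,i) * y $ i = \<bar>T $$ (f,i)\<bar> * norm (v $ i)"
        using \<omega>[OF i] i by (simp add: G_nth[OF f i] y_def)
    qed
    obtain i where i: "i < n" and "v $ i \<noteq> 0" using v by (auto simp: vec_eq_iff)
    then have "0 < \<Omega> $$ (i,i) * (norm (v $ i))\<^sup>2" using \<omega> by simp
    also have "\<dots> \<le> y \<bullet> y"
      unfolding yy using i \<omega> by (intro member_le_sum) (auto simp: less_imp_le)
    finally have pos: "y \<bullet> y > 0" .
    have "norm k * (y \<bullet> y)
        \<le> 1/4 * (\<Sum>f<m. \<bar>F $$ (f,f)\<bar> * (\<Sum>i<n. \<bar>T $$ (f,i)\<bar> * norm (v $ i))\<^sup>2)"
      unfolding yy using eigenvalue_convective_le[OF T inc \<omega> F assms(9) ev] .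
    also have "\<dots> = 1/4 * (y \<bullet> (?H *\<^sub>v y))"
      unfolding weighted_gram_form[OF G y]
      by (intro arg_cong[where f = "\<lambda>s. 1/4 * s"] sum.cong refl) (simp only: Gy lessThan_iff)
    also have "\<dots> \<le> 1/4 * (\<rho> ?H * (y \<bullet> y))"
      using Rayleigh_quotient_le_spectral_radius[OF H symmetric_weighted_gram[OF G] y n] by simp
    finally have "norm k * (y \<bullet> y) \<le> (1/4 * \<rho> ?N) * (y \<bullet> y)"
      by (simp only: rho_H mult.assoc)
    then show ?thesis
      unfolding k(2) using pos by (rule mult_right_le_imp_le)
  qed
  show "1/4 * \<rho> ?N \<le> 1/4 * Max (set\<^sub>v (component_mult (diag_vec (abs_diag_powr F \<alpha>))
      (?M *\<^sub>v diag_vec (abs_diag_powr F (1 - \<alpha>)))))"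
    using spectral_radius_diag_powr_le_Max[OF F M m M_nonneg, of \<alpha>] by simp
qed

end
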